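(* Let $k\ge 2$. On all instances in which every job has processing time exactly $k$ (and arbitrary positive weights), the Conservative Algorithm is $5$-competitive: for every such instance $I$, $\mathrm{OPT}(I)\le 5\,\mathrm{ALG}(I)$.
   Context: Model: online preemptive scheduling on a single machine (preemption with resume) in discrete time. Each job $j$ has an integer release time $r_j$, integer processing time $p_j$, integer deadline $d_j$ and positive real weight $w_j$; job $j$ becomes known only at time $r_j$. At each integer time $t$ the machine processes at most one unit of one job, occupying $[t,t+1)$; a job is completed on time if it receives $p_j$ units of processing at integer times $t$ with $r_j\le t<d_j$. $\mathrm{ALG}(I)$ is the total weight of jobs the algorithm completes on time on $I$; $\mathrm{OPT}(I)$ is the maximum total weight achievable by an offline schedule. For the algorithm, $q_j(t)$ is the remaining processing time of $j$ at time $t$, and $j$ is pending at $t$ if $r_j\le t$, $j$ is not completed, and $t+q_j(t)\le d_j$. Conservative Algorithm: at every time step, process a pending job $j$ maximizing the priority $2^{-q_j(t)/k}\,w_j$ (if any job is pending). *)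

theory Defs
  imports Complex_Main
begin

record 'a sched_instance =
  jobs :: "'a set"
  release :: "'a \<Rightarrow> int"
  proc :: "'a \<Rightarrow> nat"
  deadline :: "'a \<Rightarrow> int"
  weight :: "'a \<Rightarrow> real"

definition valid_instance :: "'a sched_instance \<Rightarrow> bool" where
  "valid_instance I \<longleftrightarrow> finite (jobs I) \<and> (\<forall>j\<in>jobs I. proc I j > 0 \<and> weight I j > 0)"

text \<open>A schedule maps each integer time \<open>t\<close> to the job occupying \<open>[t, t+1)\<close>, or to \<open>None\<close> if
  the machine idles. Units given to a job outside its window \<open>[release, deadline)\<close>, or in excess
  of its processing time, are allowed but never useful.\<close>

type_synonym 'a schedule = "int \<Rightarrow> 'a option"

definition on_time :: "'a sched_instance \<Rightarrow> 'a schedule \<Rightarrow> 'a \<Rightarrow> bool" where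
  "on_time I \<sigma> j \<longleftrightarrow>
     proc I j \<le> card {t. release I j \<le> t \<and> t < deadline I j \<and> \<sigma> t = Some j}"

definition throughput :: "'a sched_instance \<Rightarrow> 'a schedule \<Rightarrow> real" where
  "throughput I \<sigma> = (\<Sum>j | j \<in> jobs I \<and> on_time I \<sigma> j. weight I j)"

definition OPT :: "'a sched_instance \<Rightarrow> real" where
  "OPT I = Max (range (throughput I))"

definition remaining :: "'a sched_instance \<Rightarrow> 'a schedule \<Rightarrow> 'a \<Rightarrow> int \<Rightarrow> int" where
  "remaining I \<sigma> j t =
     int (proc I j) - int (card {s. release I j \<le> s \<and> s < t \<and> \<sigma> s = Some j})"

definition pending :: "'a sched_instance \<Rightarrow> 'a schedule \<Rightarrow> int \<Rightarrow> 'a set" where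
  "pending I \<sigma> t = {j \<in> jobs I. release I j \<le> t \<and> remaining I \<sigma> j t > 0 \<and>
     t + remaining I \<sigma> j t \<le> deadline I j}"

definition priority :: "nat \<Rightarrow> 'a sched_instance \<Rightarrow> 'a schedule \<Rightarrow> int \<Rightarrow> 'a \<Rightarrow> real" where
  "priority k I \<sigma> t j = 2 powr (- real_of_int (remaining I \<sigma> j t) / real k) * weight I j"

definition conservative_choice ::
  "nat \<Rightarrow> 'a sched_instance \<Rightarrow> 'a schedule \<Rightarrow> int \<Rightarrow> 'a option \<Rightarrow> bool" where
  "conservative_choice k I \<sigma> t x \<longleftrightarrow>
     (if pending I \<sigma> t = {} then x = None
      else \<exists>j. x = Some j \<and> is_arg_max (priority k I \<sigma> t) (\<lambda>i. i \<in> pending I \<sigma> t) j)"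

text \<open>The schedules the Conservative Algorithm can produce, ties between jobs of maximal priority
  being broken arbitrarily. Everything on which the choice at time \<open>t\<close> depends concerns jobs
  released by \<open>t\<close> and the schedule strictly before \<open>t\<close>.\<close>

definition conservative_run :: "nat \<Rightarrow> 'a sched_instance \<Rightarrow> 'a schedule \<Rightarrow> bool" where
  "conservative_run k I \<sigma> \<longleftrightarrow> (\<forall>t. conservative_choice k I \<sigma> t (\<sigma> t))"

lemma finite_range_throughput:
  assumes "finite (jobs I)"
  shows "finite (range (throughput I))"
proof (rule finite_subset)
  show "range (throughput I) \<subseteq> sum (weight I) ` Pow (jobs I)"
    by (auto simp: throughput_def)
  show "finite (sum (weight I) ` Pow (jobs I))"
    using assms by simp
qed

lemma conservative_run_exists:
  assumes "finite (jobs I)"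
  shows "\<exists>\<sigma>. conservative_run k I \<sigma>"
proof -
  obtain T where T: "\<And>j. j \<in> jobs I \<Longrightarrow> T \<le> release I j"
  proof
    show "Min (release I ` jobs I) \<le> release I j" if "j \<in> jobs I" for j
      using assms that by simp
  qed
  let ?R = "int_ge_less_than T"
  have "\<exists>\<sigma>. \<forall>t. conservative_choice k I \<sigma> t (\<sigma> t)"
  proof (rule dependent_wf_choice[OF wf_int_ge_less_than])
    fix \<sigma> \<tau> :: "'a schedule" and t x
    assume eq: "\<And>s. (s, t) \<in> ?R \<Longrightarrow> \<sigma> s = \<tau> s"
    have rem: "remaining I \<sigma> j t = remaining I \<tau> j t" if "j \<in> jobs I" for j
    proof -
      have "{s. release I j \<le> s \<and> s < t \<and> \<sigma> s = Some j} =
            {s. release I j \<le> s \<and> s < t \<and> \<tau> s = Some j}"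
        using eq T[OF that] by (auto simp: int_ge_less_than_def)
      then show ?thesis by (simp add: remaining_def)
    qed
    have pend: "pending I \<sigma> t = pending I \<tau> t"
      using rem by (auto simp: pending_def)
    have "priority k I \<sigma> t j = priority k I \<tau> t j" if "j \<in> pending I \<tau> t" for j
      using that rem by (auto simp: priority_def pending_def)
    then have "is_arg_max (priority k I \<sigma> t) (\<lambda>i. i \<in> pending I \<tau> t) j \<longleftrightarrow>
        is_arg_max (priority k I \<tau> t) (\<lambda>i. i \<in> pending I \<tau> t) j" for j
      by (auto simp: is_arg_max_def)
    then show "conservative_choice k I \<sigma> t x = conservative_choice k I \<tau> t x"
      by (simp add: conservative_choice_def pend)
  next
    fix t and \<sigma> :: "'a schedule"
    have fin: "finite (pending I \<sigma> t)"
      using assms by (simp add: pending_def)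
    show "\<exists>x. conservative_choice k I \<sigma> t x"
    proof (cases "pending I \<sigma> t = {}")
      case False
      let ?P = "priority k I \<sigma> t ` pending I \<sigma> t"
      have "Max ?P \<in> ?P" using False fin by (intro Max_in) auto
      then obtain j where "j \<in> pending I \<sigma> t" "priority k I \<sigma> t j = Max ?P" by force
      moreover have "\<forall>i\<in>pending I \<sigma> t. priority k I \<sigma> t i \<le> Max ?P" using fin by simp
      ultimately have "is_arg_max (priority k I \<sigma> t) (\<lambda>i. i \<in> pending I \<sigma> t) j"
        by (auto simp: is_arg_max_linorder)
      then show ?thesis using False by (auto simp: conservative_choice_def)
    qed (simp add: conservative_choice_def)
  qed
  then show ?thesis by (simp add: conservative_run_def)
qed

end

(*
  Jobs of the optimum completed by the algorithm pay for themselves; it remains to bound the total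
  weight of the missed jobs by four times the algorithm's value.  Between two completions the priority
  p(t) of the processed job grows at least by the factor 2^(1/k) per step.  If j is missed and a is the
  first unit of j in the optimal schedule, then p \<ge> w_j / 2 holds from a up to a completion time e with
  d_j \<le> e + k.  Fix a threshold x.  The optimal units of missed jobs of weight at least x lie in the
  maximal intervals of {t. p t \<ge> x / 2}, each prolonged by k - 1 slots, so an interval of length n
  hosts at most n / k such jobs, rounded up.  Cut the times before each completion into
  blocks of length k, counted backwards from the completion; then there are at most as many missed
  jobs of weight at least x as blocks whose last slot t has 2 p(t) \<ge> x.  Hence the missed weight is
  at most the sum of 2 p(t) over the block ends, and by growth this is a geometric series for each
  completed job, with sum at most 4 times its weight.
*)
theory Submission
  imports Defs "HOL-Library.Disjoint_Sets"
begin

section \<open>Comparison of sums through their level sets\<close>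

text \<open>Induction: match a heaviest \<open>a\<close> with some \<open>b\<close> such that
  \<open>v a \<le> w b\<close> and remove both. At levels up to \<open>v a\<close> both counts drop
  by one; at higher levels the left count is zero.\<close>

lemma sum_le_sum_by_level_counts:
  fixes v :: "'a \<Rightarrow> real" and w :: "'b \<Rightarrow> real"
  assumes "finite A" "finite B"
    and "\<And>a. a \<in> A \<Longrightarrow> v a > 0" "\<And>b. b \<in> B \<Longrightarrow> w b \<ge> 0"
    and "\<And>\<theta>. \<theta> > 0 \<Longrightarrow> card {a \<in> A. \<theta> \<le> v a} \<le> card {b \<in> B. \<theta> \<le> w b}"
  shows "sum v A \<le> sum w B"
  using assms
proof (induction "card A" arbitrary: A B)
  case 0
  then show ?case by (simp add: sum_nonneg)
next
  case (Suc n)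
  have neA: "A \<noteq> {}" using Suc.hyps(2) by auto
  have "Max (v ` A) \<in> v ` A" using Suc.prems(1) neA by (intro Max_in) auto
  then obtain a where "a \<in> A" "v a = Max (v ` A)" by force
  then have a: "a \<in> A" "\<And>x. x \<in> A \<Longrightarrow> v x \<le> v a"
    using Suc.prems(1) by simp_all
  have "card {x \<in> A. v a \<le> v x} > 0"
    using Suc.prems(1) a by (auto simp: card_gt_0_iff)
  then have "card {b \<in> B. v a \<le> w b} > 0"
    using Suc.prems(3)[OF a(1)] Suc.prems(5)[of "v a"] by linarith
  then obtain b where b: "b \<in> B" "v a \<le> w b"
    by (auto simp: card_gt_0_iff)
  have "sum v (A - {a}) \<le> sum w (B - {b})"
  proof (rule Suc.hyps(1))
    fix \<theta> :: real assume \<theta>: "\<theta> > 0"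
    show "card {x \<in> A - {a}. \<theta> \<le> v x} \<le> card {x \<in> B - {b}. \<theta> \<le> w x}"
    proof (cases "\<theta> \<le> v a")
      case True
      have "{x \<in> A - {a}. \<theta> \<le> v x} = {x \<in> A. \<theta> \<le> v x} - {a}"
        and "{x \<in> B - {b}. \<theta> \<le> w x} = {x \<in> B. \<theta> \<le> w x} - {b}" by auto
      then show ?thesis
        using Suc.prems(5)[OF \<theta>] True a b by (simp add: card_Diff_singleton)
    next
      case False
      then have "{x \<in> A - {a}. \<theta> \<le> v x} = {}" using a(2) by force
      then show ?thesis by (simp only: card.empty)
    qed
  qed (use Suc a in auto)
  then show ?case
    using a(1) b Suc.prems(1,2) by (simp add: sum.remove[of A a] sum.remove[of B b])
qed

section \<open>Maximal runs of a finite set of integers\<close>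

lemma run_end:
  fixes P :: "int set"
  assumes fin: "finite P" and t: "t \<in> P"
  defines "f \<equiv> Min {f \<in> P. t \<le> f \<and> f + 1 \<notin> P}"
  shows "f \<in> P" "f + 1 \<notin> P" "t \<le> f" "{t..f} \<subseteq> P"
proof -
  let ?S = "{f \<in> P. t \<le> f \<and> f + 1 \<notin> P}"
  have "Max P \<in> ?S"
  proof -
    have "Max P \<in> P" using fin t by (intro Max_in) auto
    moreover have "Max P + 1 \<notin> P" using Max_ge[OF fin, of "Max P + 1"] by auto
    ultimately show ?thesis using Max_ge[OF fin t] by simp
  qed
  then have "f \<in> ?S"
    unfolding f_def using fin by (intro Min_in) auto
  then show f: "f \<in> P" "f + 1 \<notin> P" "t \<le> f" by auto
  have "u \<in> P" if "t \<le> u" "u \<le> f" for u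
    using that
  proof (induction u rule: int_ge_induct)
    case (step u)
    show ?case
    proof (rule ccontr)
      assume "u + 1 \<notin> P"
      then have "f \<le> u"
        unfolding f_def using step fin by (intro Min_le) auto
      then show False using step by simp
    qed
  qed (use t in simp)
  then show "{t..f} \<subseteq> P" by auto
qed

text \<open>No gap of \<open>P\<close> lies between \<open>t\<close> and \<open>r\<close>, so both
  searches stop at the same place. The right end can therefore serve as the label of a run.\<close>

lemma run_end_eqI:
  fixes P :: "int set"
  assumes le: "t \<le> r" and sub: "{t..r} \<subseteq> P"
  shows "Min {f \<in> P. r \<le> f \<and> f + 1 \<notin> P} = Min {f \<in> P. t \<le> f \<and> f + 1 \<notin> P}"
proof -
  have "r \<le> f" if "t \<le> f" "f + 1 \<notin> P" for f
    using that subsetD[OF sub, of "f + 1"] by (cases "r \<le> f") auto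
  then have "{f \<in> P. r \<le> f \<and> f + 1 \<notin> P} = {f \<in> P. t \<le> f \<and> f + 1 \<notin> P}"
    using le by auto
  then show ?thesis by simp
qed

text \<open>In a maximal run \<open>C\<close> of \<open>P\<close> all job units lie in \<open>C\<close> extended by \<open>k - 1\<close> slots, so \<open>n\<close> jobs
  need \<open>n * k \<le> card C + k - 1\<close>, while \<open>card C\<close> is at most \<open>k\<close> times the number of marked points.\<close>

lemma card_le_marked_points:
  fixes P E :: "int set" and a e :: "'j \<Rightarrow> int" and U :: "'j \<Rightarrow> int set"
  assumes fin: "finite P" "finite J" and k: "k > 0"
    and ae: "\<And>j. j \<in> J \<Longrightarrow> a j \<le> e j" "\<And>j. j \<in> J \<Longrightarrow> {a j..e j} \<subseteq> P"
    and U: "\<And>j. j \<in> J \<Longrightarrow> U j \<subseteq> {a j..<e j + int k}" "\<And>j. j \<in> J \<Longrightarrow> k \<le> card (U j)"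
    and disj: "disjoint_family_on U J"
    and mark: "\<And>t. t \<in> P \<Longrightarrow> \<exists>r\<in>E. t \<le> r \<and> r < t + int k \<and> {t..r} \<subseteq> P"
  shows "card J \<le> card (E \<inter> P)"
proof -
  define g where "g t = Min {f \<in> P. t \<le> f \<and> f + 1 \<notin> P}" for t
  define C where "C f = {t \<in> P. g t = f}" for f
  have aP: "a j \<in> P" if "j \<in> J" for j using ae[OF that] by auto
  have gP: "g t \<in> P" if "t \<in> P" for t
    using run_end(1)[OF fin(1) that] by (simp add: g_def)
  have same: "g r = g t" if "t \<le> r" "{t..r} \<subseteq> P" for t r
    using run_end_eqI[OF that] by (simp add: g_def)
  have fibre: "card {j \<in> J. g (a j) = f} \<le> card {t \<in> E \<inter> P. g t = f}" for f
  proof -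
    let ?J = "{j \<in> J. g (a j) = f}" and ?M = "{t \<in> E \<inter> P. g t = f}"
    have finC: "finite (C f)" using fin by (simp add: C_def)
    have Usub: "U j \<subseteq> C f \<union> {f + 1..<f + int k}" if j: "j \<in> ?J" for j
    proof
      fix t assume "t \<in> U j"
      then have t: "a j \<le> t" "t < e j + int k" using U(1)[of j] j by auto
      have run: "f + 1 \<notin> P" "a j \<le> f" "{a j..f} \<subseteq> P"
        using run_end[OF fin(1) aP, of j] j by (auto simp: g_def)
      \<comment> \<open>The interval \<open>{a j..e j}\<close> lies in \<open>P\<close> and starts
        at or before \<open>f\<close>, so it cannot reach across the gap
        \<open>f + 1\<close>.\<close>
      have "e j \<le> f"
        using run(1,2) subsetD[OF ae(2), of j "f + 1"] j by (cases "e j \<le> f") auto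
      show "t \<in> C f \<union> {f + 1..<f + int k}"
      proof (cases "t \<le> f")
        case True
        then have "{a j..t} \<subseteq> P" using run(3) by auto
        then have "t \<in> C f" using same[of "a j" t] t(1) j by (auto simp: C_def)
        then show ?thesis by simp
      qed (use t \<open>e j \<le> f\<close> in auto)
    qed
    have finU: "finite (U j)" if "j \<in> J" for j
      using U(1)[OF that] by (rule finite_subset) simp
    have "k * card ?J = (\<Sum>j\<in>?J. k)" by simp
    also have "\<dots> \<le> (\<Sum>j\<in>?J. card (U j))" using U(2) by (intro sum_mono) auto
    also have "\<dots> = card (\<Union>j\<in>?J. U j)"
      using disj fin(2) finU by (intro card_UN_disjoint[symmetric]) (auto simp: disjoint_family_on_def)
    also have "\<dots> \<le> card (C f \<union> {f + 1..<f + int k})"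
      using Usub finC by (intro card_mono) auto
    also have "\<dots> \<le> card (C f) + (k - 1)"
      using card_Un_le[of "C f" "{f + 1..<f + int k}"] by (simp add: nat_diff_distrib')
    also have "card (C f) \<le> k * card ?M"
    proof -
      \<comment> \<open>The marked point found for \<open>t\<close> lies in the same run as
        \<open>t\<close>, so windows of \<open>k\<close> slots ending at marked points of the run
        cover it.\<close>
      have "C f \<subseteq> (\<Union>r\<in>?M. {r - int k<..r})"
      proof
        fix t assume t: "t \<in> C f"
        then obtain r where r: "r \<in> E" "t \<le> r" "r < t + int k" "{t..r} \<subseteq> P"
          using mark by (auto simp: C_def)
        then have "r \<in> ?M" using same[of t r] t by (auto simp: C_def)
        then show "t \<in> (\<Union>r\<in>?M. {r - int k<..r})" using r by force
      qed
      then have "card (C f) \<le> card (\<Union>r\<in>?M. {r - int k<..r})"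
        using fin by (intro card_mono) auto
      also have "\<dots> \<le> (\<Sum>r\<in>?M. card {r - int k<..r})"
        using fin by (intro card_UN_le) auto
      finally show ?thesis by (simp add: mult.commute)
    qed
    finally have "k * card ?J \<le> k * card ?M + (k - 1)" by simp
    \<comment> \<open>The overhang is only \<open>k - 1\<close>, less than one full job, so
      integrality absorbs it.\<close>
    also have "\<dots> < k * Suc (card ?M)" using k by simp
    finally have "card ?J < Suc (card ?M)" by (simp only: mult_less_cancel1)
    then show ?thesis by simp
  qed
  have "card J = (\<Sum>f\<in>P. card {j \<in> J. g (a j) = f})"
    using sum.group[of J P "\<lambda>j. g (a j)" "\<lambda>_. 1::nat"] fin gP aP by (simp add: image_subset_iff)
  also have "\<dots> \<le> (\<Sum>f\<in>P. card {t \<in> E \<inter> P. g t = f})"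
    using fibre by (intro sum_mono) auto
  also have "\<dots> = card (E \<inter> P)"
    using sum.group[of "E \<inter> P" P g "\<lambda>_. 1::nat"] fin gP by (simp add: image_subset_iff)
  finally show ?thesis .
qed

section \<open>Geometric growth between completions\<close>

text \<open>\<open>p t\<close> stands for the priority of the job processed at time \<open>t\<close> (\<open>0\<close> when idle) and \<open>c t\<close> says
  that this job is completed in \<open>[t, t+1)\<close>.\<close>

locale priority_profile =
  fixes k :: nat and p :: "int \<Rightarrow> real" and c :: "int \<Rightarrow> bool"
  assumes k: "k > 0"
    and finite_busy: "finite {t. p t > 0}"
    and busy_if_completes: "\<And>t. c t \<Longrightarrow> p t > 0"
    and growth: "\<And>t. p t > 0 \<Longrightarrow> \<not> c t \<Longrightarrow> 2 powr (1 / real k) * p t \<le> p (t + 1)"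
begin

lemma finite_completes: "finite {t. c t}"
  using finite_busy by (rule rev_finite_subset) (use busy_if_completes in auto)

lemma growth_iterate:
  assumes "p t > 0" "\<And>s. t \<le> s \<Longrightarrow> s < t + int n \<Longrightarrow> \<not> c s"
  shows "2 powr (real n / real k) * p t \<le> p (t + int n)"
  using assms(2)
proof (induction n)
  case (Suc n)
  then have IH: "2 powr (real n / real k) * p t \<le> p (t + int n)" by simp
  then have "p (t + int n) > 0"
    using assms(1) by (smt (verit) mult_pos_pos powr_gt_zero)
  then have step: "2 powr (1 / real k) * p (t + int n) \<le> p (t + int n + 1)"
    using Suc.prems by (intro growth) auto
  have "2 powr (real (Suc n) / real k) * p t = 2 powr (1 / real k) * (2 powr (real n / real k) * p t)"
    by (simp add: powr_add add_divide_distrib)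
  also have "\<dots> \<le> 2 powr (1 / real k) * p (t + int n)"
    using IH by (intro mult_left_mono) auto
  also note step
  finally show ?case by (simp add: algebra_simps)
qed simp

definition next_completion :: "int \<Rightarrow> int" where
  "next_completion t = Min {e. t \<le> e \<and> c e}"

text \<open>Without a later completion, growth would keep \<open>p\<close> positive forever, against
  \<open>finite_busy\<close>. Hence the set under \<open>Min\<close> is nonempty whenever
  \<open>p t > 0\<close>.\<close>

lemma next_completion:
  assumes "p t > 0"
  shows "c (next_completion t)" "t \<le> next_completion t"
    and "t \<le> s \<Longrightarrow> s < next_completion t \<Longrightarrow> \<not> c s"
proof -
  have fin: "finite {e. t \<le> e \<and> c e}" using finite_completes by simp
  have ne: "{e. t \<le> e \<and> c e} \<noteq> {}"
  proof
    assume *: "{e. t \<le> e \<and> c e} = {}"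
    have "p (t + int n) > 0" for n
      using growth_iterate[OF assms, of n] * assms by (smt (verit) Collect_empty_eq mult_pos_pos powr_gt_zero)
    then have "range (\<lambda>n. t + int n) \<subseteq> {t. p t > 0}" by auto
    then have "finite (range (\<lambda>n. t + int n))" using finite_busy finite_subset by blast
    then show False by (subst (asm) finite_image_iff) (auto simp: inj_on_def)
  qed
  show "c (next_completion t)" "t \<le> next_completion t"
    using Min_in[OF fin ne] by (auto simp: next_completion_def)
  show "\<not> c s" if "t \<le> s" "s < next_completion t"
    using that Min_le[OF fin, of s] by (auto simp: next_completion_def)
qed

lemma next_completion_eq:
  assumes "p t > 0" "t \<le> s" "s \<le> next_completion t"
  shows "next_completion s = next_completion t"
proof -
  have "{e. s \<le> e \<and> c e} = {e. t \<le> e \<and> c e}"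
    using assms next_completion(3)[OF assms(1)] by (auto, force)
  then show ?thesis by (simp add: next_completion_def)
qed

lemma powr_growth_le:
  assumes "p t > 0" "t \<le> s" "s \<le> next_completion t"
  shows "2 powr (real_of_int (s - t) / real k) * p t \<le> p s"
  using growth_iterate[OF assms(1), of "nat (s - t)"] next_completion(3)[OF assms(1)] assms(2,3)
  by auto

lemma mono_to_next_completion:
  assumes "p t > 0" "t \<le> s" "s \<le> next_completion t"
  shows "p t \<le> p s"
proof -
  have "1 \<le> 2 powr (real_of_int (s - t) / real k)"
    using assms(2) by (intro ge_one_powr_ge_zero) auto
  then have "1 * p t \<le> 2 powr (real_of_int (s - t) / real k) * p t"
    using assms(1) by (intro mult_right_mono) auto
  then show ?thesis using powr_growth_le[OF assms] by simp
qed

definition block_ends :: "int set" where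
  "block_ends = {t. p t > 0 \<and> int k dvd next_completion t - t}"

text \<open>Growth over \<open>m\<close> blocks of \<open>k\<close> slots doubles \<open>p\<close>
  at least \<open>m\<close> times, so a block end \<open>m\<close> blocks before \<open>e\<close>
  contributes at most \<open>p e / 2 ^ m\<close>. Distinct block ends have distinct
  \<open>m\<close>, and the full series sums to 2.\<close>

lemma sum_block_ends_le: "sum p block_ends \<le> 2 * (\<Sum>e | c e. p e)"
proof -
  have fin: "finite block_ends" using finite_busy by (simp add: block_ends_def)
  have "sum p block_ends = (\<Sum>e | c e. sum p {t \<in> block_ends. next_completion t = e})"
    using fin finite_completes next_completion(1)
    by (intro sum.group[symmetric]) (auto simp: block_ends_def)
  also have "\<dots> \<le> (\<Sum>e | c e. 2 * p e)"
  proof (rule sum_mono)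
    fix e assume "e \<in> {e. c e}"
    let ?T = "{t \<in> block_ends. next_completion t = e}"
    let ?m = "\<lambda>t. nat ((e - t) div int k)"
    have T: "p t > 0" "t \<le> e" "e - t = int (?m t) * int k" if "t \<in> ?T" for t
    proof -
      show "p t > 0" "t \<le> e" using that next_completion(2)[of t] by (auto simp: block_ends_def)
      then show "e - t = int (?m t) * int k" using that k by (auto simp: block_ends_def pos_imp_zdiv_nonneg_iff)
    qed
    have inj: "inj_on ?m ?T"
    proof (rule inj_onI)
      fix x y assume "x \<in> ?T" "y \<in> ?T" "?m x = ?m y"
      then have "e - x = e - y" using T(3)[of x] T(3)[of y] by metis
      then show "x = y" by simp
    qed
    have bound: "p t \<le> p e * (1/2) ^ ?m t" if t: "t \<in> ?T" for t
    proof -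
      have "real_of_int (e - t) / real k = real (?m t)"
        using arg_cong[OF T(3)[OF t], of real_of_int] k
        by (simp del: of_int_diff of_nat_nat int_nat_eq)
      then have "2 ^ ?m t * p t \<le> p e"
        using powr_growth_le[of t e] t T(1,2)[OF t] by (simp add: powr_realpow)
      then show ?thesis by (simp add: field_simps power_one_over)
    qed
    have "sum p ?T \<le> (\<Sum>t\<in>?T. p e * (1/2) ^ ?m t)"
      using bound by (rule sum_mono)
    also have "\<dots> = p e * (\<Sum>m\<in>?m ` ?T. (1/2) ^ m)"
      using inj by (simp add: sum.reindex sum_distrib_left)
    also have "(\<Sum>m\<in>?m ` ?T. (1/2::real) ^ m) \<le> (\<Sum>m. (1/2) ^ m)"
      using fin by (intro sum_le_suminf summable_geometric) auto
    also have "(\<Sum>m. (1/2::real) ^ m) = 2"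
      by (subst suminf_geometric) auto
    finally show "sum p ?T \<le> 2 * p e"
      using busy_if_completes \<open>e \<in> {e. c e}\<close> by (simp add: mult.commute)
  qed
  finally show ?thesis by (simp add: sum_distrib_left)
qed

text \<open>Level counts compare the weights with \<open>2 * p\<close> on the block ends: at level
  \<theta>, \<open>card_le_marked_points\<close> is applied to the set where \<open>p\<close> is at
  least \<theta>/2.\<close>

lemma sum_weights_le:
  fixes a e :: "'j \<Rightarrow> int" and U :: "'j \<Rightarrow> int set" and w :: "'j \<Rightarrow> real"
  assumes fin: "finite J" and w: "\<And>j. j \<in> J \<Longrightarrow> w j > 0"
    and ae: "\<And>j. j \<in> J \<Longrightarrow> a j \<le> e j"
    and high: "\<And>j t. j \<in> J \<Longrightarrow> a j \<le> t \<Longrightarrow> t \<le> e j \<Longrightarrow> w j / 2 \<le> p t"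
    and U: "\<And>j. j \<in> J \<Longrightarrow> U j \<subseteq> {a j..<e j + int k}" "\<And>j. j \<in> J \<Longrightarrow> k \<le> card (U j)"
    and disj: "disjoint_family_on U J"
  shows "sum w J \<le> 4 * (\<Sum>e | c e. p e)"
proof -
  have "sum w J \<le> (\<Sum>t\<in>block_ends. 2 * p t)"
  proof (rule sum_le_sum_by_level_counts)
    show "finite block_ends" using finite_busy by (simp add: block_ends_def)
    fix \<theta> :: real assume \<theta>: "\<theta> > 0"
    let ?J = "{j \<in> J. \<theta> \<le> w j}" and ?P = "{t. \<theta> / 2 \<le> p t}"
    have "card ?J \<le> card (block_ends \<inter> ?P)"
    proof (rule card_le_marked_points)
      show "finite ?P" using finite_busy by (rule rev_finite_subset) (use \<theta> in auto)
      show "{a j..e j} \<subseteq> ?P" if "j \<in> ?J" for j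
        using high[of j] that by force
      show "disjoint_family_on U ?J" using disj by (auto simp: disjoint_family_on_def)
      fix t assume t: "t \<in> ?P"
      then have pt: "p t > 0" using \<theta> by simp
      \<comment> \<open>Advancing by the remainder leads to the last slot of the block containing
        \<open>t\<close>, fewer than \<open>k\<close> slots ahead and not past the
        completion.\<close>
      define r where "r = t + (next_completion t - t) mod int k"
      have r: "t \<le> r" "r < t + int k" using k by (auto simp: r_def)
      have "(next_completion t - t) mod int k \<le> next_completion t - t"
        using next_completion(2)[OF pt] by (intro zmod_le_nonneg_dividend) auto
      then have r_le: "r \<le> next_completion t" by (simp add: r_def)
      have sub: "{t..r} \<subseteq> ?P"
        using mono_to_next_completion[OF pt] r_le t by force
      have "next_completion t - r = (next_completion t - t) - (next_completion t - t) mod int k"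
        by (simp add: r_def)
      then have "int k dvd next_completion t - r" by (metis dvd_minus_mod)
      then have "r \<in> block_ends"
        using next_completion_eq[OF pt r(1) r_le] mono_to_next_completion[OF pt r(1) r_le] pt
        by (simp add: block_ends_def)
      then show "\<exists>r\<in>block_ends. t \<le> r \<and> r < t + int k \<and> {t..r} \<subseteq> ?P"
        using r sub by blast
    qed (use fin k ae U in auto)
    also have "block_ends \<inter> ?P = {t \<in> block_ends. \<theta> \<le> 2 * p t}" by auto
    finally show "card ?J \<le> card {t \<in> block_ends. \<theta> \<le> 2 * p t}" .
  qed (use fin w in \<open>auto simp: block_ends_def\<close>)
  also have "\<dots> = 2 * sum p block_ends" by (simp add: sum_distrib_left)
  finally show ?thesis using sum_block_ends_le by simp
qed

end

section \<open>The conservative run as a priority profile\<close>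

locale equal_length_run =
  fixes k :: nat and I :: "'a sched_instance" and \<sigma> :: "'a schedule"
  assumes k: "k > 0" and valid: "valid_instance I"
    and equal: "\<And>j. j \<in> jobs I \<Longrightarrow> proc I j = k"
    and run: "conservative_run k I \<sigma>"
begin

abbreviation q :: "'a \<Rightarrow> int \<Rightarrow> int" where
  "q \<equiv> remaining I \<sigma>"

definition prio :: "int \<Rightarrow> real" where
  "prio t = (case \<sigma> t of None \<Rightarrow> 0 | Some j \<Rightarrow> priority k I \<sigma> t j)"

text \<open>\<open>q\<close> is measured before the slot, so the value 1 means that slot
  \<open>t\<close> supplies the last unit.\<close>

definition completes :: "int \<Rightarrow> bool" where
  "completes t \<longleftrightarrow> (\<exists>j. \<sigma> t = Some j \<and> q j t = 1)"

lemma weight_pos: "j \<in> jobs I \<Longrightarrow> weight I j > 0"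
  using valid by (simp add: valid_instance_def)

lemma finite_jobs: "finite (jobs I)"
  using valid by (simp add: valid_instance_def)

lemma pending_if_run: "\<sigma> t = Some j \<Longrightarrow> j \<in> pending I \<sigma> t"
  using run unfolding conservative_run_def conservative_choice_def
  by (metis is_arg_max_linorder option.distinct(1) option.inject)

lemma priority_le_prio:
  assumes "j \<in> pending I \<sigma> t" shows "priority k I \<sigma> t j \<le> prio t"
proof -
  obtain i where "\<sigma> t = Some i" "is_arg_max (priority k I \<sigma> t) (\<lambda>i. i \<in> pending I \<sigma> t) i"
    using run assms unfolding conservative_run_def conservative_choice_def by (metis empty_iff)
  then show ?thesis using assms by (auto simp: prio_def is_arg_max_linorder)
qed

lemma prio_pos_iff: "prio t > 0 \<longleftrightarrow> \<sigma> t \<noteq> None"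
  using pending_if_run[of t] weight_pos
  by (auto simp: prio_def priority_def pending_def split: option.splits)

lemma remaining_Suc:
  assumes "release I j \<le> t"
  shows "q j (t + 1) = q j t - (if \<sigma> t = Some j then 1 else 0)"
proof -
  let ?W = "\<lambda>t. {s. release I j \<le> s \<and> s < t \<and> \<sigma> s = Some j}"
  have fin: "finite (?W t)" by (rule finite_subset[of _ "{release I j..<t}"]) auto
  have "?W (t + 1) = (if \<sigma> t = Some j then insert t (?W t) else ?W t)"
    using assms by (auto simp: order.order_iff_strict)
  then show ?thesis using fin by (simp add: remaining_def)
qed

lemma remaining_le: "j \<in> jobs I \<Longrightarrow> q j t \<le> int k"
  by (simp add: remaining_def equal)

lemma remaining_antimono: "s \<le> t \<Longrightarrow> q j t \<le> q j s"
proof -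
  assume "s \<le> t"
  moreover have "finite {u. release I j \<le> u \<and> u < t \<and> \<sigma> u = Some j}"
    by (rule finite_subset[of _ "{release I j..<t}"]) auto
  ultimately have "card {u. release I j \<le> u \<and> u < s \<and> \<sigma> u = Some j}
      \<le> card {u. release I j \<le> u \<and> u < t \<and> \<sigma> u = Some j}"
    by (intro card_mono) auto
  then show "q j t \<le> q j s" by (simp add: remaining_def)
qed

text \<open>Processing a pending job preserves its laxity \<open>d - t - q\<close>.\<close>

lemma pending_Suc:
  assumes "\<sigma> t = Some j" "q j t \<noteq> 1"
  shows "j \<in> pending I \<sigma> (t + 1)"
  using pending_if_run[OF assms(1)] assms remaining_Suc[of j t] by (auto simp: pending_def)

text \<open>The unfinished job stays pending with one unit less to go, which multiplies its priority
  by exactly \<open>2 powr (1 / k)\<close>; the greedy choice at \<open>t + 1\<close> is at least as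
  good.\<close>

lemma prio_growth:
  assumes "prio t > 0" "\<not> completes t"
  shows "2 powr (1 / real k) * prio t \<le> prio (t + 1)"
proof -
  obtain j where j: "\<sigma> t = Some j" "q j t \<noteq> 1"
    using assms by (auto simp: prio_pos_iff completes_def)
  have "q j (t + 1) = q j t - 1"
    using remaining_Suc[of j t] pending_if_run[OF j(1)] j(1) by (simp add: pending_def)
  then have "2 powr (1 / real k) * prio t = priority k I \<sigma> (t + 1) j"
    using j(1) by (simp add: prio_def priority_def powr_add[symmetric] diff_divide_distrib
        flip: mult.assoc)
  also have "\<dots> \<le> prio (t + 1)"
    using pending_Suc[OF j] by (rule priority_le_prio)
  finally show ?thesis .
qed

lemma finite_busy: "finite {t. prio t > 0}"
proof (rule finite_subset)
  show "{t. prio t > 0} \<subseteq> (\<Union>j\<in>jobs I. {release I j..<deadline I j})"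
    using pending_if_run by (force simp: prio_pos_iff pending_def)
qed (use finite_jobs in auto)

sublocale priority_profile k prio completes
  using k finite_busy prio_growth
  by unfold_locales (auto simp: prio_pos_iff completes_def)

text \<open>The run processes only pending jobs, so every unit it gives to \<open>j\<close> lies
  before the deadline.\<close>

lemma on_time_if_done:
  assumes j: "j \<in> jobs I" and "q j t \<le> 0"
  shows "on_time I \<sigma> j"
proof -
  have "{s. release I j \<le> s \<and> s < t \<and> \<sigma> s = Some j}
      \<subseteq> {s. release I j \<le> s \<and> s < deadline I j \<and> \<sigma> s = Some j}"
    using pending_if_run by (force simp: pending_def)
  moreover have "finite {s. release I j \<le> s \<and> s < deadline I j \<and> \<sigma> s = Some j}"
    by (rule finite_subset[of _ "{release I j..<deadline I j}"]) auto
  ultimately have "card {s. release I j \<le> s \<and> s < t \<and> \<sigma> s = Some j}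
      \<le> card {s. release I j \<le> s \<and> s < deadline I j \<and> \<sigma> s = Some j}"
    by (intro card_mono)
  then show ?thesis using assms by (simp add: remaining_def on_time_def)
qed

text \<open>At a completion the priority is \<open>2 powr (-1 / k)\<close> times the weight, hence
  at most the weight, and no job completes twice.\<close>

lemma sum_completions_le: "(\<Sum>t | completes t. prio t) \<le> throughput I \<sigma>"
proof -
  let ?job = "\<lambda>t. the (\<sigma> t)"
  have c: "\<sigma> t = Some (?job t)" "q (?job t) t = 1" "q (?job t) (t + 1) = 0" "?job t \<in> jobs I"
    if "completes t" for t
    using that pending_if_run[of t] remaining_Suc[of "?job t" t]
    by (auto simp: completes_def pending_def)
  have inj: "inj_on ?job {t. completes t}"
  proof (rule linorder_inj_onI)
    fix s t assume st: "s < t" "s \<in> {t. completes t}" "t \<in> {t. completes t}"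
    show "?job s \<noteq> ?job t"
    proof
      assume "?job s = ?job t"
      then have "q (?job t) t \<le> 0" using remaining_antimono[of "s + 1" t "?job t"] c(3)[of s] st by simp
      then show False using c(2)[of t] st by simp
    qed
  qed auto
  have "(\<Sum>t | completes t. prio t) \<le> (\<Sum>t | completes t. weight I (?job t))"
  proof (rule sum_mono)
    fix t assume "t \<in> {t. completes t}"
    then have t: "completes t" by simp
    have "2 powr (- 1 / real k) \<le> (2::real) powr 0" by (intro powr_mono) auto
    then have "2 powr (- 1 / real k) * weight I (?job t) \<le> 1 * weight I (?job t)"
      using weight_pos[OF c(4)[OF t]] by (intro mult_right_mono) auto
    moreover have "prio t = 2 powr (- 1 / real k) * weight I (?job t)"
      using c(2)[OF t] by (subst prio_def, subst c(1)[OF t]) (simp add: priority_def)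
    ultimately show "prio t \<le> weight I (?job t)" by simp
  qed
  also have "\<dots> = sum (weight I) (?job ` {t. completes t})"
    using inj by (simp add: sum.reindex)
  also have "\<dots> \<le> throughput I \<sigma>"
    unfolding throughput_def
  proof (rule sum_mono2)
    show "?job ` {t. completes t} \<subseteq> {j \<in> jobs I. on_time I \<sigma> j}"
      using on_time_if_done[OF c(4) eq_refl[OF c(3)]] c(4) by auto
  qed (use finite_jobs weight_pos in \<open>auto intro: less_imp_le\<close>)
  finally show ?thesis .
qed

section \<open>Charging the missed jobs\<close>

text \<open>Since \<open>q j t \<le> k\<close>, the priority factor of a pending job never falls
  below 1/2.\<close>

lemma half_weight_le_prio:
  assumes "j \<in> pending I \<sigma> t" shows "weight I j / 2 \<le> prio t"
proof -
  have j: "j \<in> jobs I" using assms by (simp add: pending_def)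
  have "(2::real) powr (-1) \<le> 2 powr (- real_of_int (q j t) / real k)"
    using remaining_le[OF j, of t] k by (intro powr_mono) (auto simp: field_simps)
  then have "2 powr (-1) * weight I j \<le> 2 powr (- real_of_int (q j t) / real k) * weight I j"
    using weight_pos[OF j] by (intro mult_right_mono) auto
  then have "weight I j / 2 \<le> priority k I \<sigma> t j"
    by (simp add: priority_def powr_minus_divide)
  then show ?thesis using priority_le_prio[OF assms] by simp
qed

text \<open>Let \<open>s\<close> be the last time up to which \<open>j\<close> stays pending after \<open>a\<close>. Then \<open>j\<close> has laxity \<open>0\<close> at \<open>s\<close>,
  so \<open>d = s + q\<close> with \<open>q \<le> k\<close>, and the first completion from \<open>s\<close> on serves as \<open>e\<close>.\<close>

lemma missed_job_window:
  assumes j: "j \<in> jobs I" "\<not> on_time I \<sigma> j" and a: "release I j \<le> a" "a + int k \<le> deadline I j"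
  shows "\<exists>e\<ge>a. deadline I j \<le> e + int k \<and> (\<forall>t. a \<le> t \<and> t \<le> e \<longrightarrow> weight I j / 2 \<le> prio t)"
proof -
  let ?P = "{t. a \<le> t \<and> j \<in> pending I \<sigma> t}"
  have q_pos: "q j t > 0" for t
    using on_time_if_done[of j t] j by force
  have fin: "finite ?P"
    by (rule finite_subset[of _ "{a..<deadline I j}"]) (auto simp: pending_def)
  have aP: "a \<in> ?P"
    using a j q_pos[of a] remaining_le[OF j(1), of a] by (auto simp: pending_def)
  define s where "s = Min {f \<in> ?P. a \<le> f \<and> f + 1 \<notin> ?P}"
  have s: "s \<in> ?P" "s + 1 \<notin> ?P" "{a..s} \<subseteq> ?P"
    using run_end[OF fin aP] by (simp_all add: s_def)
  have rs: "release I j \<le> s" using s(1) a(1) by auto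
  \<comment> \<open>As \<open>q\<close> stays positive, only the deadline can end pendency at
    \<open>s + 1\<close>. Processing \<open>j\<close> at \<open>s\<close> would have kept its
    laxity, so \<open>j\<close> was not processed there and its laxity had run out.\<close>
  have d: "deadline I j \<le> s + q j s"
    using s(1,2) q_pos[of "s + 1"] remaining_Suc[OF rs] by (auto simp: pending_def split: if_splits)
  have ps: "prio s > 0"
    using half_weight_le_prio[of j s] s(1) weight_pos[OF j(1)] by auto
  let ?e = "next_completion s"
  show ?thesis
  proof (intro exI conjI allI impI)
    show "a \<le> ?e" using next_completion(2)[OF ps] s(1) by simp
    show "deadline I j \<le> ?e + int k"
      using next_completion(2)[OF ps] d remaining_le[OF j(1), of s] by simp
    fix t assume t: "a \<le> t \<and> t \<le> ?e"
    show "weight I j / 2 \<le> prio t"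
    proof (cases "t \<le> s")
      case True
      then show ?thesis using s(3) t by (intro half_weight_le_prio) auto
    next
      case False
      \<comment> \<open>Past \<open>s\<close> the bound is inherited from \<open>prio s\<close>,
        since \<open>prio\<close> does not fall up to and including the next completion.\<close>
      then have "prio s \<le> prio t" using mono_to_next_completion[OF ps] t by simp
      then show ?thesis using half_weight_le_prio[of j s] s(1) by simp
    qed
  qed
qed

lemma throughput_le: "throughput I \<tau> \<le> 5 * throughput I \<sigma>"
proof -
  let ?A = "{j \<in> jobs I. on_time I \<sigma> j}"
  let ?J = "{j \<in> jobs I. on_time I \<tau> j} - ?A"
  define U where "U j = {t. release I j \<le> t \<and> t < deadline I j \<and> \<tau> t = Some j}" for j
  have finU: "finite (U j)" for j
    unfolding U_def by (rule finite_subset[of _ "{release I j..<deadline I j}"]) auto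
  have cardU: "k \<le> card (U j)" if "j \<in> ?J" for j
    using that equal by (auto simp: on_time_def U_def)
  define a where "a j = Min (U j)" for j
  have aU: "a j \<in> U j" "\<And>t. t \<in> U j \<Longrightarrow> a j \<le> t" if "j \<in> ?J" for j
    using Min_in[OF finU, of j] Min_le[OF finU, of _ j] cardU[OF that] k
    by (cases "U j = {}"; simp add: a_def)+
  \<comment> \<open>All of the at least \<open>k\<close> units of \<open>j\<close> in \<tau> lie
    between \<open>a j\<close> and the deadline.\<close>
  have ad: "a j + int k \<le> deadline I j" if "j \<in> ?J" for j
  proof -
    have "U j \<subseteq> {a j..<deadline I j}" using aU(2)[OF that] by (auto simp: U_def)
    then have "card (U j) \<le> card {a j..<deadline I j}" by (intro card_mono) auto
    then show ?thesis using cardU[OF that] k by simp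
  qed
  have "\<forall>j\<in>?J. \<exists>e. a j \<le> e \<and> deadline I j \<le> e + int k \<and>
      (\<forall>t. a j \<le> t \<and> t \<le> e \<longrightarrow> weight I j / 2 \<le> prio t)"
  proof
    fix j assume j: "j \<in> ?J"
    then show "\<exists>e\<ge>a j. deadline I j \<le> e + int k \<and>
        (\<forall>t. a j \<le> t \<and> t \<le> e \<longrightarrow> weight I j / 2 \<le> prio t)"
      using ad[OF j] aU(1)[OF j] by (intro missed_job_window) (auto simp: U_def)
  qed
  from bchoice[OF this] obtain e where e: "\<And>j. j \<in> ?J \<Longrightarrow> a j \<le> e j" "\<And>j. j \<in> ?J \<Longrightarrow> deadline I j \<le> e j + int k"
    "\<And>j t. j \<in> ?J \<Longrightarrow> a j \<le> t \<Longrightarrow> t \<le> e j \<Longrightarrow> weight I j / 2 \<le> prio t"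
    by blast
  have missed: "sum (weight I) ?J \<le> 4 * (\<Sum>t | completes t. prio t)"
  proof (rule sum_weights_le[of _ _ a e U])
    show "U j \<subseteq> {a j..<e j + int k}" if "j \<in> ?J" for j
      using aU(2)[OF that] e(2)[OF that] by (force simp: U_def)
    show "disjoint_family_on U ?J" by (auto simp: disjoint_family_on_def U_def)
  qed (use finite_jobs weight_pos e cardU in auto)
  \<comment> \<open>Every job in \<open>?A\<close> is counted, whether or not \<tau> completes it;
    this is the one extra share beyond the factor 4.\<close>
  have "throughput I \<tau> \<le> sum (weight I) (?A \<union> ?J)"
    unfolding throughput_def using finite_jobs weight_pos
    by (intro sum_mono2) (auto intro: less_imp_le)
  also have "\<dots> = throughput I \<sigma> + sum (weight I) ?J"
    unfolding throughput_def using finite_jobs by (intro sum.union_disjoint) auto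
  finally show ?thesis using missed sum_completions_le by simp
qed

end

theorem theorem3:
  fixes k :: nat and I :: "'a sched_instance" and \<sigma> :: "'a schedule"
  assumes "k \<ge> 2"
    and "valid_instance I"
    and "\<forall>j\<in>jobs I. proc I j = k"
    and "conservative_run k I \<sigma>"
  shows "OPT I \<le> 5 * throughput I \<sigma>"
proof -
  interpret equal_length_run k I \<sigma>
    using assms by unfold_locales auto
  show ?thesis
    unfolding OPT_def using finite_range_throughput[OF finite_jobs] throughput_le
    by (subst Max_le_iff) auto
qed

end
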